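(* Let $r\ge1$ be an integer, let $S:\mathbb{R}^{r+1}\to\mathbb{R}$ be a local potential satisfying conditions A, B and C, and let $\omega\in\mathbb{R}\setminus\mathbb{Q}$. Assume that $\mathcal{M}_\omega$ is a lamination for $S$. Then there exists $\delta>0$ such that for every local potential $S^\delta:\mathbb{R}^{r+1}\to\mathbb{R}$ satisfying conditions A, B and C with $\|S^\delta-S\|_{C^0}<\delta$ and $\|S^\delta-S\|_{C^1}\le1$, the set $\mathcal{M}_\omega$ for $S^\delta$ is also a lamination.
   Context: Conditions on $S:\mathbb{R}^{r+1}\to\mathbb{R}$, written as $S(x_0,\dots,x_r)$: A (periodicity): $S(x_0+1,\dots,x_r+1)=S(x_0,\dots,x_r)$ for all arguments. B (monotonicity): $S$ is $C^2$, $\partial_i\partial_k S\le 0$ everywhere for all $i\ne k$, and $\partial_0\partial_1 S<0$ everywhere. C (coercivity): $S$ is bounded from below and there is $k\in\{0,\dots,r-1\}$ such that $S(x_0,\dots,x_r)\to\infty$ as $|x_{k+1}-x_k|\to\infty$. For integers $i_0\le i_1$ and $x:\mathbb{Z}\to\mathbb{R}$ let $W_{[i_0,i_1]}(x)=\sum_{j=i_0}^{i_1}S(x_j,\dots,x_{j+r})$. A sequence $x$ is a global minimizer (for $S$) if $W_{[i_0,i_1]}(x)\le W_{[i_0,i_1]}(x+v)$ for all finite intervals $[i_0,i_1]\subset\mathbb{Z}$ and all $v:\mathbb{Z}\to\mathbb{R}$ with support in $[i_0+r,i_1]$. For $k,l\in\mathbb{Z}$ put $(\tau_{k,l}x)_i=x_{i-k}+l$;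 $x$ is Birkhoff if $\{\tau_{k,l}x: k,l\in\mathbb{Z}\}$ is totally ordered by the pointwise order $x\le y\iff x_i\le y_i$ for all $i$. Every Birkhoff $x$ has a unique rotation number $\omega(x)$, with $|x_i-x_0-\omega(x) i|\le1$ for all $i$. $\mathcal{M}_\omega$ is the set of Birkhoff global minimizers of rotation number $\omega$. It is a foliation if for every $\xi\in\mathbb{R}$ there is $x\in\mathcal{M}_\omega$ with $x_0=\xi$; otherwise it is a lamination. $\|\cdot\|_{C^0}$ is the supremum norm on $\mathbb{R}^{r+1}$, and $\|\cdot\|_{C^1}$ is the maximum of the suprema of the absolute values of the function and of its first partial derivatives. *)

theory Defs
  imports "HOL-Analysis.Analysis"
begin

text \<open>
  A function on \<open>(r+1)\<close>-dimensional real space is represented by a function of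
  type \<open>(nat \<Rightarrow> real) \<Rightarrow> real\<close> whose value depends on the coordinates
  \<open>0, \<dots>, r\<close> only. For such functions, continuity with respect to the product
  topology on \<open>nat \<Rightarrow> real\<close> coincides with ordinary continuity.
\<close>

definition local_potential :: "nat \<Rightarrow> ((nat \<Rightarrow> real) \<Rightarrow> real) \<Rightarrow> bool" where
  "local_potential r S \<longleftrightarrow> (\<forall>x y. (\<forall>i\<le>r. x i = y i) \<longrightarrow> S x = S y)"

definition partial_deriv :: "nat \<Rightarrow> ((nat \<Rightarrow> real) \<Rightarrow> real) \<Rightarrow> (nat \<Rightarrow> real) \<Rightarrow> real" where
  "partial_deriv i f x = deriv (\<lambda>t. f (x(i := t))) (x i)"

primrec C_k :: "nat \<Rightarrow> nat \<Rightarrow> ((nat \<Rightarrow> real) \<Rightarrow> real) \<Rightarrow> bool" where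
  "C_k r 0 f \<longleftrightarrow> continuous_on UNIV f"
| "C_k r (Suc n) f \<longleftrightarrow> continuous_on UNIV f \<and>
     (\<forall>i\<le>r. (\<forall>x. (\<lambda>t. f (x(i := t))) differentiable (at (x i))) \<and> C_k r n (partial_deriv i f))"

definition periodic_potential :: "((nat \<Rightarrow> real) \<Rightarrow> real) \<Rightarrow> bool" where
  "periodic_potential S \<longleftrightarrow> (\<forall>x. S (\<lambda>i. x i + 1) = S x)"

definition monotone_potential :: "nat \<Rightarrow> ((nat \<Rightarrow> real) \<Rightarrow> real) \<Rightarrow> bool" where
  "monotone_potential r S \<longleftrightarrow>
     C_k r 2 S \<and>
     (\<forall>i\<le>r. \<forall>k\<le>r. i \<noteq> k \<longrightarrow> (\<forall>x. partial_deriv i (partial_deriv k S) x \<le> 0)) \<and>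
     (\<forall>x. partial_deriv 0 (partial_deriv 1 S) x < 0)"

text \<open>
  The limit as \<open>\<bar>x (k + 1) - x k\<bar>\<close> tends to infinity is uniform in the remaining coordinates.
\<close>

definition coercive_potential :: "nat \<Rightarrow> ((nat \<Rightarrow> real) \<Rightarrow> real) \<Rightarrow> bool" where
  "coercive_potential r S \<longleftrightarrow>
     bdd_below (range S) \<and>
     (\<exists>k<r. filterlim S at_top (filtercomap (\<lambda>x. \<bar>x (k + 1) - x k\<bar>) at_top))"

text \<open>The norms take the value \<open>\<infinity>\<close> on functions for which the suprema are not finite.\<close>

definition C0_norm :: "((nat \<Rightarrow> real) \<Rightarrow> real) \<Rightarrow> ereal" where
  "C0_norm f = (SUP x. ereal \<bar>f x\<bar>)"

definition C1_norm :: "nat \<Rightarrow> ((nat \<Rightarrow> real) \<Rightarrow> real) \<Rightarrow> ereal" where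
  "C1_norm r f = max (C0_norm f) (SUP i\<in>{0..r}. C0_norm (partial_deriv i f))"

definition action :: "((nat \<Rightarrow> real) \<Rightarrow> real) \<Rightarrow> int \<Rightarrow> int \<Rightarrow> (int \<Rightarrow> real) \<Rightarrow> real" where
  "action S i0 i1 x = (\<Sum>j=i0..i1. S (\<lambda>i. x (j + int i)))"

definition global_minimizer :: "nat \<Rightarrow> ((nat \<Rightarrow> real) \<Rightarrow> real) \<Rightarrow> (int \<Rightarrow> real) \<Rightarrow> bool" where
  "global_minimizer r S x \<longleftrightarrow>
     (\<forall>i0 i1 v. i0 \<le> i1 \<longrightarrow> {i. v i \<noteq> 0} \<subseteq> {i0 + int r..i1} \<longrightarrow>
        action S i0 i1 x \<le> action S i0 i1 (\<lambda>i. x i + v i))"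

definition translate :: "int \<Rightarrow> int \<Rightarrow> (int \<Rightarrow> real) \<Rightarrow> int \<Rightarrow> real" where
  "translate k l x = (\<lambda>i. x (i - k) + of_int l)"

text \<open>The order on \<open>int \<Rightarrow> real\<close> is the pointwise one.\<close>

definition Birkhoff :: "(int \<Rightarrow> real) \<Rightarrow> bool" where
  "Birkhoff x \<longleftrightarrow>
     (\<forall>y\<in>{translate k l x |k l. True}. \<forall>z\<in>{translate k l x |k l. True}. y \<le> z \<or> z \<le> y)"

definition rotation_number :: "(int \<Rightarrow> real) \<Rightarrow> real" where
  "rotation_number x = (THE w. \<forall>i. \<bar>x i - x 0 - w * of_int i\<bar> \<le> 1)"

lemma Birkhoff_differences:
  assumes "Birkhoff x"
  shows "\<exists>p::int. \<forall>i. of_int p \<le> x (i + n) - x i \<and> x (i + n) - x i \<le> of_int p + 1"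
proof -
  have cmp: "(\<forall>i. x i + of_int l \<le> x (i + n)) \<or> (\<forall>i. x (i + n) \<le> x i + of_int l)" for l
  proof -
    have "translate 0 l x \<in> {translate k l x |k l. True}"
      and "translate (- n) 0 x \<in> {translate k l x |k l. True}"
      by blast+
    with assms have "translate 0 l x \<le> translate (- n) 0 x \<or> translate (- n) 0 x \<le> translate 0 l x"
      unfolding Birkhoff_def by blast
    then show ?thesis
      by (simp add: translate_def le_fun_def)
  qed
  define p where "p = \<lfloor>x n - x 0\<rfloor>"
  have p: "of_int p \<le> x n - x 0" "x n - x 0 < of_int p + 1"
    unfolding p_def by linarith+
  have up: "x (i + n) \<le> x i + of_int (p + 1)" for i
  proof -
    have "\<not> x 0 + of_int (p + 1) \<le> x (0 + n)" using p by simp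
    then show ?thesis using cmp[of "p + 1"] by blast
  qed
  have lo: "x i + of_int (p - 1) \<le> x (i + n)" for i
  proof -
    have "\<not> x (0 + n) \<le> x 0 + of_int (p - 1)" using p by simp
    then show ?thesis using cmp[of "p - 1"] by blast
  qed
  from cmp[of p] show ?thesis
  proof
    assume a: "\<forall>i. x i + of_int p \<le> x (i + n)"
    have "of_int p \<le> x (i + n) - x i \<and> x (i + n) - x i \<le> of_int p + 1" for i
      using a[rule_format, of i] up[of i] by simp
    then show ?thesis by blast
  next
    assume a: "\<forall>i. x (i + n) \<le> x i + of_int p"
    have "of_int (p - 1) \<le> x (i + n) - x i \<and> x (i + n) - x i \<le> of_int (p - 1) + 1" for i
      using a[rule_format, of i] lo[of i] by simp
    then show ?thesis by blast
  qed
qed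

theorem Birkhoff_rotation_number:
  assumes "Birkhoff x"
  shows "\<exists>!w. \<forall>i. \<bar>x i - x 0 - w * of_int i\<bar> \<le> 1"
proof -
  obtain p :: "int \<Rightarrow> int" where
    p: "\<And>n i. of_int (p n) \<le> x (i + n) - x i \<and> x (i + n) - x i \<le> of_int (p n) + 1"
    using Birkhoff_differences[OF assms] by metis
  have iter: "real m * of_int (p n) \<le> x (int m * n) - x 0 \<and>
      x (int m * n) - x 0 \<le> real m * (of_int (p n) + 1)" for m n
  proof (induction m)
    case (Suc m)
    have "int (Suc m) * n = int m * n + n" by (simp add: algebra_simps)
    with Suc p[where n=n and i="int m * n"] show ?case by (simp add: algebra_simps)
  qed simp
  have cross: "of_int (p n) / of_int n \<le> (of_int (p m) + 1) / (of_int m :: real)"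
    if "n > 0" "m > 0" for n m
  proof -
    have "of_int m * of_int (p n) \<le> x (m * n) - x 0"
      using iter[of "nat m" n] that by simp
    also have "\<dots> \<le> of_int n * (of_int (p m) + 1)"
      using iter[of "nat n" m] that by (simp add: mult.commute)
    finally show ?thesis using that by (simp add: divide_simps mult.commute)
  qed
  define A where "A = (\<lambda>n. of_int (p n) / of_int n :: real) ` {0<..}"
  define w where "w = Sup A"
  have bdd: "bdd_above A"
    unfolding A_def by (rule bdd_aboveI2) (use cross[of _ 1] in auto)
  have w: "of_int (p n) \<le> w * of_int n \<and> w * of_int n \<le> of_int (p n) + 1" if "n > 0" for n
  proof -
    have "of_int (p n) / of_int n \<le> w"
      unfolding w_def by (rule cSup_upper[OF _ bdd]) (use that in \<open>auto simp: A_def\<close>)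
    moreover have "w \<le> (of_int (p n) + 1) / of_int n"
      unfolding w_def
    proof (rule cSup_least)
      show "A \<noteq> {}" by (auto simp: A_def)
    qed (use cross that in \<open>auto simp: A_def\<close>)
    ultimately show ?thesis using that by (simp add: divide_simps split: if_splits)
  qed
  have ex: "\<bar>x i - x 0 - w * of_int i\<bar> \<le> 1" for i
  proof (cases i "0::int" rule: linorder_cases)
    case less
    then show ?thesis using w[of "- i"] p[where n="- i" and i=i] by simp linarith
  next
    case greater
    then show ?thesis using w[of i] p[where n=i and i=0] by simp linarith
  qed simp
  have uniq: "u = v"
    if u: "\<forall>i. \<bar>x i - x 0 - u * of_int i\<bar> \<le> 1" and v: "\<forall>i. \<bar>x i - x 0 - v * of_int i\<bar> \<le> 1"
    for u v :: real
  proof (rule ccontr)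
    assume "u \<noteq> v"
    then obtain n where n: "2 < real n * \<bar>u - v\<bar>"
      using reals_Archimedean3[of "\<bar>u - v\<bar>"] by auto
    have "real n * \<bar>u - v\<bar> = \<bar>u * real n - v * real n\<bar>"
      by (simp flip: left_diff_distrib add: abs_mult mult.commute)
    also have "\<dots> \<le> 2"
      using u[rule_format, of "int n"] v[rule_format, of "int n"] by simp
    finally show False using n by simp
  qed
  from ex uniq show ?thesis by blast
qed

corollary rotation_number_eq_iff:
  assumes "Birkhoff x"
  shows "rotation_number x = w \<longleftrightarrow> (\<forall>i. \<bar>x i - x 0 - w * of_int i\<bar> \<le> 1)"
  unfolding rotation_number_def
  using theI'[OF Birkhoff_rotation_number[OF assms]] the1_equality[OF Birkhoff_rotation_number[OF assms]]
  by blast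

definition Birkhoff_minimizers :: "nat \<Rightarrow> ((nat \<Rightarrow> real) \<Rightarrow> real) \<Rightarrow> real \<Rightarrow> (int \<Rightarrow> real) set" where
  "Birkhoff_minimizers r S \<omega> = {x. Birkhoff x \<and> global_minimizer r S x \<and> rotation_number x = \<omega>}"

definition is_foliation :: "(int \<Rightarrow> real) set \<Rightarrow> bool" where
  "is_foliation M \<longleftrightarrow> (\<forall>\<xi>. \<exists>x\<in>M. x 0 = \<xi>)"

definition is_lamination :: "(int \<Rightarrow> real) set \<Rightarrow> bool" where
  "is_lamination M \<longleftrightarrow> \<not> is_foliation M"

end

theory Submission imports Defs begin

text \<open>
  Suppose potentials \<open>T n\<close> converge uniformly to \<open>S\<close> while each \<open>\<M>\<^sub>\<omega>\<close> for \<open>T n\<close> is a foliation,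
  and let \<open>\<xi>\<close> be arbitrary. Pick minimizers \<open>X n\<close> for \<open>T n\<close> through \<open>\<xi>\<close> at site \<open>0\<close>. The rotation
  number bound confines all of them to the same product of compact intervals, so a subsequence
  converges pointwise. The Birkhoff property, the rotation number bound and the minimization
  inequalities each involve finitely many coordinates, hence pass to the limit. The limit is thus a
  Birkhoff minimizer for \<open>S\<close> through \<open>\<xi>\<close>, so \<open>\<M>\<^sub>\<omega>\<close> for \<open>S\<close> is a foliation as well.
\<close>

text \<open>Tychonoff's theorem for a product of compact intervals, transferred from the abstract
  product topology to the function type.\<close>

lemma compact_pointwise_bounds:
  fixes a b :: "'i \<Rightarrow> real"
  shows "compact {x. \<forall>i. a i \<le> x i \<and> x i \<le> b i}"
proof -
  have "compactin (product_topology (\<lambda>i. euclidean) UNIV) (PiE UNIV (\<lambda>i. {a i..b i}))"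
    unfolding compactin_PiE by simp
  moreover have "PiE UNIV (\<lambda>i. {a i..b i}) = {x. \<forall>i. a i \<le> x i \<and> x i \<le> b i}"
    by (auto simp: PiE_UNIV_domain)
  ultimately show ?thesis
    by (simp add: euclidean_product_topology)
qed

lemma tendsto_coordinate:
  fixes X :: "'a \<Rightarrow> 'i \<Rightarrow> 'b::topological_space"
  assumes "(X \<longlongrightarrow> x) F"
  shows "((\<lambda>n. X n i) \<longlongrightarrow> x i) F"
  by (rule continuous_on_tendsto_compose[OF continuous_on_product_coordinates assms]) auto

text \<open>Each summand sees \<open>x\<close> through the window map sending \<open>x\<close> to
  \<open>\<lambda>i. x (j + int i)\<close>. This map is continuous between the product topologies
  because each of its coordinates is a coordinate of \<open>x\<close>.\<close>

lemma continuous_on_action: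
  assumes "continuous_on UNIV S"
  shows "continuous_on UNIV (action S i0 i1)"
proof -
  have "continuous_on UNIV (\<lambda>x::int \<Rightarrow> real. S (\<lambda>i. x (j + int i)))" for j
    by (rule continuous_on_compose2[OF assms])
      (auto intro: continuous_on_coordinatewise_then_product)
  then show ?thesis
    unfolding action_def by (intro continuous_on_sum) auto
qed

lemma uniform_limit_sum:
  fixes f :: "'i \<Rightarrow> 'a \<Rightarrow> 'b \<Rightarrow> 'c::real_normed_vector"
  assumes "\<And>i. i \<in> I \<Longrightarrow> uniform_limit A (f i) (g i) F"
  shows "uniform_limit A (\<lambda>n x. \<Sum>i\<in>I. f i n x) (\<lambda>x. \<Sum>i\<in>I. g i x) F"
  using assms
  by (induction I rule: infinite_finite_induct) (auto intro: uniform_limit_const uniform_limit_add)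

lemma uniform_limit_action:
  assumes "uniform_limit UNIV T S F"
  shows "uniform_limit UNIV (\<lambda>n. action (T n) i0 i1) (action S i0 i1) F"
  unfolding action_def
  by (intro uniform_limit_sum uniform_limit_compose'[OF assms]) auto

text \<open>Potential and sequence vary together, so the error is split: uniform convergence of the
  actions controls the change of potential at the moving point \<open>X n\<close>, and continuity of
  the limiting action controls the change of point.\<close>

lemma tendsto_action:
  assumes "continuous_on UNIV S" "uniform_limit UNIV T S F" "(X \<longlongrightarrow> x) F"
  shows "((\<lambda>n. action (T n) i0 i1 (X n)) \<longlongrightarrow> action S i0 i1 x) F"
proof -
  have "((\<lambda>n. action S i0 i1 (X n)) \<longlongrightarrow> action S i0 i1 x) F"
    by (rule continuous_on_tendsto_compose[OF continuous_on_action[OF assms(1)] assms(3)]) auto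
  moreover have "((\<lambda>n. action (T n) i0 i1 (X n) - action S i0 i1 (X n)) \<longlongrightarrow> 0) F"
  proof (rule tendstoI)
    fix e :: real assume "e > 0"
    show "\<forall>\<^sub>F n in F. dist (action (T n) i0 i1 (X n) - action S i0 i1 (X n)) 0 < e"
      using uniform_limitD[OF uniform_limit_action[OF assms(2)] \<open>e > 0\<close>, of i0 i1]
      by eventually_elim (simp add: dist_real_def)
  qed
  ultimately have "((\<lambda>n. (action (T n) i0 i1 (X n) - action S i0 i1 (X n)) + action S i0 i1 (X n))
      \<longlongrightarrow> 0 + action S i0 i1 x) F"
    by (intro tendsto_add)
  then show ?thesis by simp
qed

text \<open>The support condition on \<open>v\<close> involves neither potential nor sequence, so
  one fixed \<open>v\<close> is admissible for every \<open>X n\<close>. Both sides of the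
  non-strict inequality then converge.\<close>

lemma global_minimizer_limit:
  assumes S: "continuous_on UNIV S" "uniform_limit UNIV T S F" and X: "(X \<longlongrightarrow> x) F"
    and F: "F \<noteq> bot" and min: "\<And>n. global_minimizer r (T n) (X n)"
  shows "global_minimizer r S x"
  unfolding global_minimizer_def
proof (intro allI impI)
  fix i0 i1 :: int and v :: "int \<Rightarrow> real"
  assume v: "i0 \<le> i1" "{i. v i \<noteq> 0} \<subseteq> {i0 + int r..i1}"
  have "continuous_on UNIV (\<lambda>y i. y i + v i)"
    by (intro continuous_on_coordinatewise_then_product continuous_on_add
        continuous_on_product_coordinates continuous_on_const)
  then have Xv: "((\<lambda>n i. X n i + v i) \<longlongrightarrow> (\<lambda>i. x i + v i)) F"
    using continuous_on_tendsto_compose[OF _ X] by fastforce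
  show "action S i0 i1 x \<le> action S i0 i1 (\<lambda>i. x i + v i)"
    using F tendsto_action[OF S Xv] tendsto_action[OF S X]
    by (rule tendsto_le) (use min v in \<open>simp add: global_minimizer_def\<close>)
qed

text \<open>Which of two translates lies below may change with \<open>n\<close>, so the argument
  goes through the negation: two translates are incomparable iff strict inequalities in opposite
  directions hold at two sites. This is an open condition, so it would already hold for some
  \<open>X n\<close>.\<close>

lemma Birkhoff_limit:
  assumes X: "(X \<longlongrightarrow> x) F" and F: "F \<noteq> bot" and Birkhoff: "\<And>n. Birkhoff (X n)"
  shows "Birkhoff x"
proof (rule ccontr)
  assume "\<not> Birkhoff x"
  then obtain k l k' l' where
    "\<not> translate k l x \<le> translate k' l' x" "\<not> translate k' l' x \<le> translate k l x"
    unfolding Birkhoff_def by blast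
  then obtain i j where ij: "translate k' l' x i < translate k l x i"
      "translate k l x j < translate k' l' x j"
    by (auto simp: le_fun_def not_le)
  have lim: "((\<lambda>n. translate k l (X n) i) \<longlongrightarrow> translate k l x i) F" for k l i
    unfolding translate_def by (intro tendsto_add tendsto_const tendsto_coordinate[OF X])
  have lt: "\<forall>\<^sub>F n in F. translate k l (X n) i < translate k' l' (X n) i"
    if "translate k l x i < translate k' l' x i" for k l k' l' i
  proof -
    obtain c where c: "translate k l x i < c" "c < translate k' l' x i"
      using dense[OF \<open>translate k l x i < translate k' l' x i\<close>] by blast
    show ?thesis
      using order_tendstoD(2)[OF lim c(1)] order_tendstoD(1)[OF lim c(2)]
      by eventually_elim (rule less_trans)
  qed
  have "\<forall>\<^sub>F n in F. translate k' l' (X n) i < translate k l (X n) i \<and>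
      translate k l (X n) j < translate k' l' (X n) j"
    using lt[OF ij(1)] lt[OF ij(2)] by (rule eventually_conj)
  then obtain n where n: "translate k' l' (X n) i < translate k l (X n) i"
      "translate k l (X n) j < translate k' l' (X n) j"
    using eventually_happens'[OF F] by blast
  have "translate k l (X n) \<le> translate k' l' (X n) \<or> translate k' l' (X n) \<le> translate k l (X n)"
    using Birkhoff[of n] unfolding Birkhoff_def by blast
  with n show False by (meson le_fun_def leD)
qed

text \<open>Replaces the definite description in \<open>rotation_number\<close> by non-strict
  inequalities, which are closed under pointwise limits.\<close>

lemma Birkhoff_minimizers_iff:
  "x \<in> Birkhoff_minimizers r S \<omega> \<longleftrightarrow> Birkhoff x \<and> global_minimizer r S x \<and>
     (\<forall>i. \<bar>x i - x 0 - \<omega> * of_int i\<bar> \<le> 1)"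
  unfolding Birkhoff_minimizers_def using rotation_number_eq_iff by blast

lemma Birkhoff_minimizers_limit:
  assumes S: "continuous_on UNIV S" "uniform_limit UNIV T S F" and X: "(X \<longlongrightarrow> x) F"
    and F: "F \<noteq> bot" and M: "\<And>n. X n \<in> Birkhoff_minimizers r (T n) \<omega>"
  shows "x \<in> Birkhoff_minimizers r S \<omega>"
proof -
  have B: "Birkhoff x"
    by (rule Birkhoff_limit[OF X F]) (use M in \<open>simp add: Birkhoff_minimizers_iff\<close>)
  moreover have "global_minimizer r S x"
    by (rule global_minimizer_limit[OF S X F]) (use M in \<open>simp add: Birkhoff_minimizers_iff\<close>)
  moreover have "\<bar>x i - x 0 - \<omega> * of_int i\<bar> \<le> 1" for i
  proof (rule tendsto_upperbound[OF _ _ F])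
    show "((\<lambda>n. \<bar>X n i - X n 0 - \<omega> * of_int i\<bar>) \<longlongrightarrow> \<bar>x i - x 0 - \<omega> * of_int i\<bar>) F"
      by (intro tendsto_intros tendsto_coordinate[OF X])
    show "\<forall>\<^sub>F n in F. \<bar>X n i - X n 0 - \<omega> * of_int i\<bar> \<le> 1"
      using M by (simp add: Birkhoff_minimizers_iff)
  qed
  ultimately show ?thesis
    by (simp add: Birkhoff_minimizers_iff)
qed

lemma foliation_uniform_limit:
  fixes T :: "nat \<Rightarrow> (nat \<Rightarrow> real) \<Rightarrow> real"
  assumes "continuous_on UNIV S" "uniform_limit UNIV T S sequentially"
    and fol: "\<And>n. is_foliation (Birkhoff_minimizers r (T n) \<omega>)"
  shows "is_foliation (Birkhoff_minimizers r S \<omega>)"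
  unfolding is_foliation_def
proof
  fix \<xi>
  have "\<forall>n. \<exists>x. x \<in> Birkhoff_minimizers r (T n) \<omega> \<and> x 0 = \<xi>"
    using fol unfolding is_foliation_def by blast
  then obtain X where X: "\<And>n. X n \<in> Birkhoff_minimizers r (T n) \<omega>" "\<And>n. X n 0 = \<xi>"
    by metis
  define K where "K = {x. \<forall>i::int. \<xi> + \<omega> * of_int i - 1 \<le> x i \<and> x i \<le> \<xi> + \<omega> * of_int i + 1}"
  have "X n \<in> K" for n
  proof -
    have "\<bar>X n i - \<xi> - \<omega> * of_int i\<bar> \<le> 1" for i
      using X(1)[of n] X(2)[of n] unfolding Birkhoff_minimizers_iff by metis
    then show ?thesis unfolding K_def by (simp add: abs_le_iff algebra_simps)
  qed
  \<comment> \<open>Compactness yields convergent subsequences here because a product over the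
    countable index set \<open>int\<close> is first countable.\<close>
  moreover have "seq_compact K"
    unfolding K_def by (rule compact_imp_seq_compact[OF compact_pointwise_bounds])
  ultimately obtain x s where s: "strict_mono (s :: nat \<Rightarrow> nat)" and x: "(X \<circ> s) \<longlonglongrightarrow> x"
    by (meson seq_compactE)
  \<comment> \<open>The potentials must follow the same subsequence \<open>s\<close> as the
    minimizers.\<close>
  have "uniform_limit UNIV (\<lambda>n. T (s n)) S sequentially"
    using filterlim_compose[OF assms(2) filterlim_subseq[OF s]] by simp
  then have "x \<in> Birkhoff_minimizers r S \<omega>"
    by (rule Birkhoff_minimizers_limit[OF assms(1) _ x]) (simp_all add: X)
  moreover have "x 0 = \<xi>"
    using tendsto_coordinate[OF x, of 0] by (simp add: X LIMSEQ_const_iff)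
  ultimately show "\<exists>x\<in>Birkhoff_minimizers r S \<omega>. x 0 = \<xi>" by blast
qed

lemma C0_norm_lessD:
  assumes "C0_norm f < ereal d"
  shows "\<bar>f x\<bar> < d"
proof -
  have "ereal \<bar>f x\<bar> \<le> C0_norm f"
    unfolding C0_norm_def by (rule SUP_upper) simp
  with assms have "ereal \<bar>f x\<bar> < ereal d" by (rule order.strict_trans1[rotated])
  then show ?thesis by simp
qed

theorem theorem1p2:
  fixes r :: nat and S :: "(nat \<Rightarrow> real) \<Rightarrow> real" and \<omega> :: real
  assumes "r \<ge> 1"
    and "local_potential r S"
    and "periodic_potential S" and "monotone_potential r S" and "coercive_potential r S"
    and "\<omega> \<notin> \<rat>"
    and "is_lamination (Birkhoff_minimizers r S \<omega>)"
  shows "\<exists>\<delta>>0. \<forall>S'. local_potential r S' \<longrightarrow>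
           periodic_potential S' \<longrightarrow> monotone_potential r S' \<longrightarrow> coercive_potential r S' \<longrightarrow>
           C0_norm (\<lambda>x. S' x - S x) < ereal \<delta> \<longrightarrow>
           C1_norm r (\<lambda>x. S' x - S x) \<le> 1 \<longrightarrow>
           is_lamination (Birkhoff_minimizers r S' \<omega>)"
proof (rule ccontr)
  assume "\<not> ?thesis"
  then have "\<exists>S'. C0_norm (\<lambda>x. S' x - S x) < ereal \<delta> \<and>
      is_foliation (Birkhoff_minimizers r S' \<omega>)" if "\<delta> > 0" for \<delta>
    using that unfolding is_lamination_def by blast
  then have "\<forall>n. \<exists>S'. C0_norm (\<lambda>x. S' x - S x) < ereal (inverse (real (Suc n))) \<and>
      is_foliation (Birkhoff_minimizers r S' \<omega>)"
    by simp
  then obtain T where T: "\<And>n. C0_norm (\<lambda>x. T n x - S x) < ereal (inverse (real (Suc n)))"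
    and fol: "\<And>n. is_foliation (Birkhoff_minimizers r (T n) \<omega>)"
    by metis
  \<comment> \<open>Rewriting \<open>2\<close> as \<open>Suc (Suc 0)\<close> lets \<open>C_k\<close>
    unfold and expose its continuity clause.\<close>
  have "continuous_on UNIV S"
    using \<open>monotone_potential r S\<close> by (simp add: monotone_potential_def numeral_2_eq_2)
  moreover have "uniform_limit UNIV T S sequentially"
  proof (rule uniform_limitI)
    fix e :: real assume "e > 0"
    have "\<forall>\<^sub>F n in sequentially. inverse (real (Suc n)) < e"
      using order_tendstoD(2)[OF LIMSEQ_inverse_real_of_nat \<open>e > 0\<close>] .
    then show "\<forall>\<^sub>F n in sequentially. \<forall>x\<in>UNIV. dist (T n x) (S x) < e"
      by eventually_elim
        (metis C0_norm_lessD[OF T] dist_real_def less_trans)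
  qed
  ultimately have "is_foliation (Birkhoff_minimizers r S \<omega>)"
    using fol by (rule foliation_uniform_limit)
  with \<open>is_lamination (Birkhoff_minimizers r S \<omega>)\<close> show False
    unfolding is_lamination_def by contradiction
qed

end
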